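(* Let $M$ be a connected surface in $E^3$ consisting only of elliptic points (i.e. its Gauss curvature satisfies $K>0$ everywhere). Then $M$ is of $II$-type $1$ if and only if $M$ is part of a sphere.
   Context: $M$ is a connected (sufficiently differentiable) surface in Euclidean 3-space $E^3$ with position vector $x=x(u^1,u^2)$ and Gauss map (unit normal) $n:M\to S^2$. The second fundamental form is $II=b_{ij}\,du^i\,du^j$ with $b_{ij}=\langle x_{/ij},n\rangle$, where $/i$ denotes $\partial/\partial u^i$; it is nondegenerate at elliptic points, and $(b^{ij})$ denotes the inverse of $(b_{ij})$. The second Beltrami operator with respect to $II$ is $\Delta^{II}\varphi:=-b^{ij}\nabla^{II}_i\varphi_{/j}$, where $\nabla^{II}_i$ is the covariant derivative (Levi-Civita connection of $II$) in the $u^i$ direction and repeated indices are summed; it is applied componentwise to vector-valued functions. The surface $M$ is of finite $II$-type if $x=c+\sum_{i=1}^m x_i$ with $c$ a constant vector and nonconstant vector-valued functions $x_i$ satisfying $\Delta^{II}x_i=\lambda_i x_i$ for real constants $\lambda_i$; it is of $II$-type $k$ if there are exactly $k$ nonconstant eigenvectors $x_1,\dots,x_k$ in such a decomposition, belonging to pairwise different eigenvalues $\lambda_1,\dots,\lambda_k$. Thus $M$ is of $II$-type $1$ if $x=c+x_1$ with $c$ constant, $x_1$ nonconstant and $\Delta^{II}x_1=\lambda x_1$ for some $\lambda\in\mathbb{R}$. *)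

theory Defs
  imports "HOL-Analysis.Analysis"
begin

definition partial ::
  "2 \<Rightarrow> (real^2 \<Rightarrow> 'b::real_normed_vector) \<Rightarrow> real^2 \<Rightarrow> 'b" where
  "partial i f u = frechet_derivative f (at u) (axis i 1)"

text \<open>\<open>C_on k U f\<close>: \<open>f\<close> is of class \<open>C\<^sup>k\<close> on \<open>U\<close>; meant for open \<open>U\<close>.\<close>

primrec C_on ::
  "nat \<Rightarrow> (real^2) set \<Rightarrow> (real^2 \<Rightarrow> 'b::real_normed_vector) \<Rightarrow> bool" where
  "C_on 0 U f \<longleftrightarrow> continuous_on U f"
| "C_on (Suc k) U f \<longleftrightarrow>
     (\<forall>u\<in>U. f differentiable (at u)) \<and> (\<forall>i. C_on k U (partial i f))"

subsection \<open>Surfaces\<close>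

text \<open>
  A surface is an abstract 2-manifold \<open>M\<close> with an immersion \<open>x\<close>, the position
  vector, into Euclidean 3-space. Its differentiable structure is the one induced by \<open>x\<close>:
  the local parametrizations are the homeomorphisms \<open>\<phi>\<close> from an open set \<open>U\<close> of
  the parameter plane onto an open set of \<open>M\<close> for which \<open>x \<circ> \<phi>\<close> is an immersion
  of class \<open>C\<^sup>3\<close> (the transition maps between these are automatically of class
  \<open>C\<^sup>3\<close>). Order 3 is the least for which the Christoffel symbols of \<open>II\<close> make
  sense. Parametrized patches and embedded surfaces are special cases.
\<close>

definition local_param ::
  "'a topology \<Rightarrow> ('a \<Rightarrow> real^3) \<Rightarrow> (real^2) set \<Rightarrow> (real^2 \<Rightarrow> 'a) \<Rightarrow> bool" where
  "local_param M x U \<phi> \<longleftrightarrow>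
     open U \<and> embedding_map (top_of_set U) M \<phi> \<and> openin M (\<phi> ` U) \<and>
     C_on 3 U (x \<circ> \<phi>) \<and>
     (\<forall>u\<in>U. inj (frechet_derivative (x \<circ> \<phi>) (at u)))"

definition surface :: "'a topology \<Rightarrow> ('a \<Rightarrow> real^3) \<Rightarrow> bool" where
  "surface M x \<longleftrightarrow>
     topspace M \<noteq> {} \<and> Hausdorff_space M \<and> second_countable M \<and>
     (\<forall>p\<in>topspace M. \<exists>U \<phi>. local_param M x U \<phi> \<and> p \<in> \<phi> ` U)"

definition gauss_map ::
  "'a topology \<Rightarrow> ('a \<Rightarrow> real^3) \<Rightarrow> ('a \<Rightarrow> real^3) \<Rightarrow> bool" where
  "gauss_map M x n \<longleftrightarrow>
     continuous_map M euclidean n \<and> (\<forall>p\<in>topspace M. norm (n p) = 1) \<and>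
     (\<forall>U \<phi>. local_param M x U \<phi> \<longrightarrow>
        (\<forall>u\<in>U. \<forall>i. partial i (x \<circ> \<phi>) u \<bullet> n (\<phi> u) = 0))"

text \<open>
  In the following, \<open>y = x \<circ> \<phi>\<close> and \<open>\<nu> = n \<circ> \<phi>\<close> are the position vector and the
  Gauss map as functions of the surface parameters.
\<close>

definition first_form :: "(real^2 \<Rightarrow> real^3) \<Rightarrow> real^2 \<Rightarrow> real^2^2" where
  "first_form y u = (\<chi> i j. partial i y u \<bullet> partial j y u)"

definition second_form ::
  "(real^2 \<Rightarrow> real^3) \<Rightarrow> (real^2 \<Rightarrow> real^3) \<Rightarrow> real^2 \<Rightarrow> real^2^2" where
  "second_form y \<nu> u = (\<chi> i j. partial j (partial i y) u \<bullet> \<nu> u)"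

definition gauss_curvature ::
  "(real^2 \<Rightarrow> real^3) \<Rightarrow> (real^2 \<Rightarrow> real^3) \<Rightarrow> real^2 \<Rightarrow> real" where
  "gauss_curvature y \<nu> u = det (second_form y \<nu> u) / det (first_form y u)"

definition elliptic_surface ::
  "'a topology \<Rightarrow> ('a \<Rightarrow> real^3) \<Rightarrow> ('a \<Rightarrow> real^3) \<Rightarrow> bool" where
  "elliptic_surface M x n \<longleftrightarrow>
     (\<forall>U \<phi>. local_param M x U \<phi> \<longrightarrow>
        (\<forall>u\<in>U. gauss_curvature (x \<circ> \<phi>) (n \<circ> \<phi>) u > 0))"

subsection \<open>The second Beltrami operator\<close>

text \<open>
  \<open>h\<close> is a (possibly indefinite, but nondegenerate) metric given by its component
  matrix; \<open>christoffel h k i j\<close> is \<open>\<Gamma>\<^sup>k\<^sub>i\<^sub>j\<close> of its Levi-Civita connection.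
  If \<open>h u\<close> is singular, \<open>matrix_inv (h u)\<close> is unspecified.
\<close>

definition christoffel ::
  "(real^2 \<Rightarrow> real^2^2) \<Rightarrow> 2 \<Rightarrow> 2 \<Rightarrow> 2 \<Rightarrow> real^2 \<Rightarrow> real" where
  "christoffel h k i j u =
     (\<Sum>l\<in>UNIV. matrix_inv (h u) $ k $ l *
        (partial i (\<lambda>v. h v $ j $ l) u + partial j (\<lambda>v. h v $ i $ l) u
         - partial l (\<lambda>v. h v $ i $ j) u)) / 2"

text \<open>\<open>cov_deriv2 h i j f\<close> is \<open>\<nabla>\<^sub>i f\<^bsub>/j\<^esub>\<close>.\<close>

definition cov_deriv2 ::
  "(real^2 \<Rightarrow> real^2^2) \<Rightarrow> 2 \<Rightarrow> 2 \<Rightarrow> (real^2 \<Rightarrow> 'b::real_normed_vector) \<Rightarrow> real^2 \<Rightarrow> 'b" where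
  "cov_deriv2 h i j f u =
     partial i (partial j f) u - (\<Sum>k\<in>UNIV. christoffel h k i j u *\<^sub>R partial k f u)"

definition beltrami2 ::
  "(real^2 \<Rightarrow> real^2^2) \<Rightarrow> (real^2 \<Rightarrow> 'b::real_normed_vector) \<Rightarrow> real^2 \<Rightarrow> 'b" where
  "beltrami2 h f u =
     - (\<Sum>i\<in>UNIV. \<Sum>j\<in>UNIV. matrix_inv (h u) $ i $ j *\<^sub>R cov_deriv2 h i j f u)"

subsection \<open>Surfaces of finite type\<close>

definition II_eigenfunction ::
  "'a topology \<Rightarrow> ('a \<Rightarrow> real^3) \<Rightarrow> ('a \<Rightarrow> real^3) \<Rightarrow> ('a \<Rightarrow> real^3) \<Rightarrow> real \<Rightarrow> bool" where
  "II_eigenfunction M x n X \<mu> \<longleftrightarrow>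
     (\<forall>U \<phi>. local_param M x U \<phi> \<longrightarrow>
        C_on 2 U (X \<circ> \<phi>) \<and>
        (\<forall>u\<in>U. beltrami2 (second_form (x \<circ> \<phi>) (n \<circ> \<phi>)) (X \<circ> \<phi>) u = \<mu> *\<^sub>R X (\<phi> u)))"

definition II_type ::
  "nat \<Rightarrow> 'a topology \<Rightarrow> ('a \<Rightarrow> real^3) \<Rightarrow> ('a \<Rightarrow> real^3) \<Rightarrow> bool" where
  "II_type k M x n \<longleftrightarrow>
     (\<exists>(c :: real^3) (X :: nat \<Rightarrow> 'a \<Rightarrow> real^3) (\<mu> :: nat \<Rightarrow> real).
        (\<forall>p\<in>topspace M. x p = c + (\<Sum>i<k. X i p)) \<and>
        (\<forall>i<k. \<not> X i constant_on topspace M \<and> II_eigenfunction M x n (X i) (\<mu> i)) \<and>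
        inj_on \<mu> {..<k})"

definition part_of_sphere :: "'a topology \<Rightarrow> ('a \<Rightarrow> real^3) \<Rightarrow> bool" where
  "part_of_sphere M x \<longleftrightarrow> (\<exists>c r. r > 0 \<and> x ` topspace M \<subseteq> sphere c r)"

end

theory Submission
  imports Defs
begin

text \<open>
  The normal component of \<open>\<Delta>\<^sup>I\<^sup>I x\<close> is \<open>-b\<^sup>i\<^sup>jb\<^sub>i\<^sub>j = -2\<close>, whatever
  the Christoffel symbols are. Hence \<open>\<Delta>\<^sup>I\<^sup>I x = \<mu> (x - c)\<close> forces \<open>\<mu> \<noteq> 0\<close> and the
  support function \<open>\<langle>x - c, n\<rangle>\<close> to be the constant \<open>h = -2/\<mu>\<close>; differentiating it, and
  using that \<open>II\<close> is nondegenerate, shows that \<open>x - c\<close> is normal, so \<open>x - c = h n\<close>.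
  Conversely, on a sphere \<open>x - c = a n\<close> with \<open>a\<close> constant by connectedness, so \<open>II\<close> is a constant
  multiple of \<open>I\<close>, both have the same Levi-Civita connection, and by Gauss' formula
  \<open>\<Delta>\<^sup>I\<^sup>I x\<close> has no tangential component, i.e. \<open>\<Delta>\<^sup>I\<^sup>I x = -2 n\<close>.
\<close>

unbundle cross3_syntax

section \<open>Partial derivatives and the classes \<open>C_on\<close>\<close>

lemma has_derivative_partial:
  assumes "f differentiable (at u)"
  shows "(f has_derivative frechet_derivative f (at u)) (at u)"
  using assms frechet_derivative_works by blast

lemma partial_eqI: "(f has_derivative f') (at u) \<Longrightarrow> partial i f u = f' (axis i 1)"
  unfolding partial_def by (metis frechet_derivative_at)

text \<open>Functions agreeing near \<open>u\<close> have the same derivatives there, so the choice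
  operator inside \<open>frechet_derivative\<close> returns the same map for both, also when no
  derivative exists.\<close>

lemma partial_cong:
  assumes "open U" "u \<in> U" "\<And>v. v \<in> U \<Longrightarrow> f v = g v"
  shows "partial i f u = partial i g u"
proof -
  have "(f has_derivative f') (at u) = (g has_derivative f') (at u)" for f'
    using assms has_derivative_transform_within_open[of f f' u UNIV U g]
      has_derivative_transform_within_open[of g f' u UNIV U f] by auto
  then show ?thesis
    unfolding partial_def frechet_derivative_def by simp
qed

lemma partial_diff_const:
  assumes "f differentiable (at u)"
  shows "partial i (\<lambda>v. f v - c) u = partial i f u"
  unfolding partial_def[of i f]
  by (rule partial_eqI) (auto intro!: derivative_eq_intros has_derivative_partial assms)

lemma partial_inner:
  fixes f g :: "real^2 \<Rightarrow> 'b::real_inner"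
  assumes "f differentiable (at u)" "g differentiable (at u)"
  shows "partial i (\<lambda>v. f v \<bullet> g v) u = f u \<bullet> partial i g u + partial i f u \<bullet> g u"
  unfolding partial_def[of i f] partial_def[of i g]
  by (rule partial_eqI) (auto intro!: derivative_eq_intros has_derivative_partial assms)

lemma C_on_cong:
  assumes "open U" "\<And>v. v \<in> U \<Longrightarrow> f v = g v"
  shows "C_on k U f \<longleftrightarrow> C_on k U g"
  using assms(2)
proof (induction k arbitrary: f g)
  case 0
  then show ?case by (simp cong: continuous_on_cong)
next
  case (Suc k)
  have "f differentiable (at u) \<longleftrightarrow> g differentiable (at u)" if "u \<in> U" for u
    unfolding differentiable_def
    using that Suc.prems assms(1) has_derivative_transform_within_open[of f _ u UNIV U g]
      has_derivative_transform_within_open[of g _ u UNIV U f] by metis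
  moreover have "C_on k U (partial i f) \<longleftrightarrow> C_on k U (partial i g)" for i
    by (rule Suc.IH) (use partial_cong[OF assms(1)] Suc.prems in blast)
  ultimately show ?case by simp
qed

lemma C_on_SucD: "C_on (Suc k) U f \<Longrightarrow> C_on k U f"
proof (induction k arbitrary: f)
  case 0
  then show ?case
    by (simp add: continuous_at_imp_continuous_on differentiable_imp_continuous_within)
next
  case (Suc k)
  then show ?case by (metis C_on.simps(2))
qed

lemma C_on_diff_const:
  assumes "open U" "C_on k U f"
  shows "C_on k U (\<lambda>u. f u - c)"
proof (cases k)
  case 0
  then show ?thesis using assms by (auto intro: continuous_intros)
next
  case (Suc l)
  have "C_on l U (partial i (\<lambda>u. f u - c)) \<longleftrightarrow> C_on l U (partial i f)" for i
    using assms(2) Suc by (intro C_on_cong assms(1) partial_diff_const) simp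
  then show ?thesis using assms Suc by simp
qed

lemma C_on_3D:
  assumes "C_on 3 U f" "u \<in> U"
  shows "f differentiable (at u)" "partial i f differentiable (at u)"
    "partial i (partial j f) differentiable (at u)"
  using assms by (simp_all add: eval_nat_numeral)

lemma C_on_3_imp_2: "C_on 3 U f \<Longrightarrow> C_on 2 U f"
  using C_on_SucD[of 2 U f] by (simp add: eval_nat_numeral)

section \<open>Symmetry of second partial derivatives\<close>

lemma has_real_derivative_partial_line:
  fixes f :: "real^2 \<Rightarrow> real"
  assumes "f differentiable (at (a + s *\<^sub>R axis i 1))"
  shows "((\<lambda>s. f (a + s *\<^sub>R axis i 1)) has_real_derivative
           partial i f (a + s *\<^sub>R axis i 1)) (at s)"
proof -
  let ?L = "frechet_derivative f (at (a + s *\<^sub>R axis i 1))"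
  have D: "(f has_derivative ?L) (at (a + s *\<^sub>R axis i 1))"
    by (rule has_derivative_partial[OF assms])
  have "((\<lambda>s. a + s *\<^sub>R axis i 1) has_derivative (\<lambda>h. h *\<^sub>R axis i 1)) (at s)"
    by (auto intro!: derivative_eq_intros)
  from diff_chain_at[OF this D]
  have "((\<lambda>s. f (a + s *\<^sub>R axis i 1)) has_derivative (\<lambda>h. ?L (h *\<^sub>R axis i 1))) (at s)"
    by (simp add: o_def)
  moreover have "?L (h *\<^sub>R axis i 1) = partial i f (a + s *\<^sub>R axis i 1) * h" for h
    using linear_frechet_derivative[OF assms] by (simp add: linear_cmul partial_def)
  ultimately show ?thesis
    by (simp add: has_field_derivative_def)
qed

text \<open>The mean value theorem is applied in direction \<open>i\<close> and then in direction
  \<open>j\<close>. The second difference is symmetric in \<open>i\<close> and \<open>j\<close>, so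
  exchanging them expresses the same number through the other mixed derivative.\<close>

lemma second_difference_mvt:
  fixes f :: "real^2 \<Rightarrow> real"
  assumes "C_on 2 U f" "t > 0" "cball u (2 * t) \<subseteq> U"
  obtains v where "dist v u \<le> 2 * t"
    "f (u + t *\<^sub>R axis i 1 + t *\<^sub>R axis j 1) - f (u + t *\<^sub>R axis i 1) - f (u + t *\<^sub>R axis j 1) + f u
       = t * t * partial j (partial i f) v"
proof -
  let ?e = "\<lambda>i. axis i 1 :: real^2"
  have near: "dist (u + s *\<^sub>R ?e i + r *\<^sub>R ?e j) u \<le> 2 * t"
    if "0 \<le> s" "s \<le> t" "0 \<le> r" "r \<le> t" for s r
    using norm_triangle_ineq[of "s *\<^sub>R ?e i" "r *\<^sub>R ?e j"] that
    by (simp add: dist_norm norm_axis_1 algebra_simps)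
  have inU: "u + s *\<^sub>R ?e i + r *\<^sub>R ?e j \<in> U"
    if "0 \<le> s" "s \<le> t" "0 \<le> r" "r \<le> t" for s r
    using near[OF that] assms(3) by (auto simp: dist_commute)
  have d1: "f differentiable (at v)" and d2: "partial i f differentiable (at v)" if "v \<in> U" for v
    using assms(1) that by (simp_all add: eval_nat_numeral)
  define G where "G = (\<lambda>s. f ((u + t *\<^sub>R ?e j) + s *\<^sub>R ?e i) - f (u + s *\<^sub>R ?e i))"
  have "(G has_real_derivative
      partial i f ((u + t *\<^sub>R ?e j) + s *\<^sub>R ?e i) - partial i f (u + s *\<^sub>R ?e i)) (at s)"
    if "0 \<le> s" "s \<le> t" for s
    unfolding G_def
    using inU[of s t] inU[of s 0] that assms(2)
    by (intro DERIV_diff has_real_derivative_partial_line d1) (simp_all add: algebra_simps)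
  from MVT2[OF assms(2) this] obtain s where s: "0 < s" "s < t" and
    Gs: "G t - G 0 = t * (partial i f ((u + t *\<^sub>R ?e j) + s *\<^sub>R ?e i) - partial i f (u + s *\<^sub>R ?e i))"
    by auto
  define H where "H = (\<lambda>r. partial i f ((u + s *\<^sub>R ?e i) + r *\<^sub>R ?e j))"
  have "(H has_real_derivative partial j (partial i f) ((u + s *\<^sub>R ?e i) + r *\<^sub>R ?e j)) (at r)"
    if "0 \<le> r" "r \<le> t" for r
    unfolding H_def
    using inU[of s r] s that by (intro has_real_derivative_partial_line d2) simp
  from MVT2[OF assms(2) this] obtain r where r: "0 < r" "r < t" and
    Hr: "H t - H 0 = t * partial j (partial i f) ((u + s *\<^sub>R ?e i) + r *\<^sub>R ?e j)"
    by auto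
  show thesis
  proof (rule that)
    show "dist ((u + s *\<^sub>R ?e i) + r *\<^sub>R ?e j) u \<le> 2 * t"
      using near s r by simp
    show "f (u + t *\<^sub>R ?e i + t *\<^sub>R ?e j) - f (u + t *\<^sub>R ?e i) - f (u + t *\<^sub>R ?e j) + f u
       = t * t * partial j (partial i f) ((u + s *\<^sub>R ?e i) + r *\<^sub>R ?e j)"
      using Gs Hr by (simp add: G_def H_def algebra_simps)
  qed
qed

lemma partial_commute_real:
  fixes f :: "real^2 \<Rightarrow> real"
  assumes "open U" "C_on 2 U f" "u \<in> U"
  shows "partial i (partial j f) u = partial j (partial i f) u"
proof (rule ccontr)
  let ?A = "partial i (partial j f)" and ?B = "partial j (partial i f)"
  assume ne: "?A u \<noteq> ?B u"
  \<comment> \<open>Half the gap: two errors below \<open>e\<close> cannot bridge a distance of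
    \<open>2 * e\<close>.\<close>
  define e where "e = \<bar>?A u - ?B u\<bar> / 2"
  have e: "e > 0" using ne by (simp add: e_def)
  have "continuous_on U ?A" "continuous_on U ?B"
    using assms(2) by (simp_all add: eval_nat_numeral)
  then have c: "isCont ?A u" "isCont ?B u"
    using assms(1,3) continuous_on_eq_continuous_at by blast+
  obtain d1 where d1: "d1 > 0" "\<And>v. dist v u < d1 \<Longrightarrow> dist (?A v) (?A u) < e"
    using c(1) e unfolding continuous_at_eps_delta by blast
  obtain d2 where d2: "d2 > 0" "\<And>v. dist v u < d2 \<Longrightarrow> dist (?B v) (?B u) < e"
    using c(2) e unfolding continuous_at_eps_delta by blast
  obtain d3 where d3: "d3 > 0" "cball u d3 \<subseteq> U"
    using assms(1,3) open_contains_cball by blast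
  \<comment> \<open>The intermediate points lie within \<open>2 * t\<close> of \<open>u\<close>;
    dividing by 3 keeps this strictly below both continuity radii.\<close>
  define t where "t = min d1 (min d2 d3) / 3"
  have t: "t > 0" "2 * t < d1" "2 * t < d2" "2 * t \<le> d3"
    using d1(1) d2(1) d3(1) by (auto simp: t_def)
  then have sub: "cball u (2 * t) \<subseteq> U"
    using d3(2) subset_cball by (meson order_trans)
  obtain v where v: "dist v u \<le> 2 * t"
    "f (u + t *\<^sub>R axis i 1 + t *\<^sub>R axis j 1) - f (u + t *\<^sub>R axis i 1) - f (u + t *\<^sub>R axis j 1) + f u
       = t * t * ?B v"
    by (rule second_difference_mvt[OF assms(2) t(1) sub])
  obtain w where w: "dist w u \<le> 2 * t"
    "f (u + t *\<^sub>R axis j 1 + t *\<^sub>R axis i 1) - f (u + t *\<^sub>R axis j 1) - f (u + t *\<^sub>R axis i 1) + f u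
       = t * t * ?A w"
    by (rule second_difference_mvt[OF assms(2) t(1) sub])
  have "t * t * ?B v = t * t * ?A w"
    using v(2) w(2) by (simp add: algebra_simps)
  then have "?B v = ?A w" using t(1) by simp
  moreover have "\<bar>?A w - ?A u\<bar> < e" "\<bar>?B v - ?B u\<bar> < e"
    using d1(2)[of w] d2(2)[of v] v(1) w(1) t by (auto simp: dist_real_def)
  moreover have "\<bar>?A u - ?B u\<bar> = 2 * e" by (simp add: e_def)
  ultimately show False by arith
qed

lemma C_on_inner_const:
  fixes f :: "real^2 \<Rightarrow> 'b::real_inner"
  assumes "open U" "C_on k U f"
  shows "C_on k U (\<lambda>u. f u \<bullet> a)"
  using assms(2)
proof (induction k arbitrary: f)
  case 0
  then show ?case by (auto intro: continuous_intros)
next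
  case (Suc k)
  have p: "partial i (\<lambda>u. f u \<bullet> a) v = partial i f v \<bullet> a" if "v \<in> U" for i v
    unfolding partial_def[of i f] using Suc.prems that
    by (intro partial_eqI) (auto intro!: derivative_eq_intros has_derivative_partial)
  have "C_on k U (partial i (\<lambda>u. f u \<bullet> a)) \<longleftrightarrow> C_on k U (\<lambda>u. partial i f u \<bullet> a)" for i
    using p by (intro C_on_cong assms(1))
  moreover have "(\<lambda>u. f u \<bullet> a) differentiable (at v)" if "v \<in> U" for v
    using Suc.prems that by auto
  ultimately show ?case using Suc by auto
qed

text \<open>Reduction to the real case: pairing with a fixed basis vector commutes with both
  differentiations.\<close>

lemma partial_commute:
  fixes f :: "real^2 \<Rightarrow> 'b::euclidean_space"
  assumes "open U" "C_on 2 U f" "u \<in> U"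
  shows "partial i (partial j f) u = partial j (partial i f) u"
proof (rule euclidean_eqI)
  fix a :: 'b
  have D: "f differentiable (at v)" "partial k f differentiable (at v)" if "v \<in> U" for v k
    using assms(2) that by (simp_all add: eval_nat_numeral)
  have c: "partial l (\<lambda>u. g u \<bullet> a) v = partial l g v \<bullet> a" if "g differentiable (at v)"
    for l v and g :: "real^2 \<Rightarrow> 'b"
    unfolding partial_def[of l g] using that
    by (intro partial_eqI) (auto intro!: derivative_eq_intros has_derivative_partial)
  have "partial l (partial k (\<lambda>u. f u \<bullet> a)) u = partial l (partial k f) u \<bullet> a" for k l
  proof -
    have "partial l (partial k (\<lambda>u. f u \<bullet> a)) u = partial l (\<lambda>u. partial k f u \<bullet> a) u"
      using assms D c by (intro partial_cong) auto
    then show ?thesis using c D assms(3) by simp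
  qed
  then show "partial i (partial j f) u \<bullet> a = partial j (partial i f) u \<bullet> a"
    using partial_commute_real[OF assms(1) C_on_inner_const[OF assms(1,2)] assms(3)] by metis
qed

section \<open>Vector algebra in 3-space and matrix inverses\<close>

lemma orthogonal_both_imp_scaleR_cross:
  fixes v a b :: "real^3"
  assumes "v \<bullet> a = 0" "v \<bullet> b = 0"
  shows "(a \<times> b \<bullet> a \<times> b) *\<^sub>R v = (v \<bullet> a \<times> b) *\<^sub>R (a \<times> b)"
proof -
  have "v \<times> (a \<times> b) = 0"
    using assms by (simp add: Lagrange)
  \<comment> \<open>With \<open>w = a \<times> b\<close>, Lagrange's identity expands
    \<open>w \<times> (v \<times> w)\<close> to
    \<open>(w \<bullet> w) *\<^sub>R v - (w \<bullet> v) *\<^sub>R w\<close>, so its vanishing is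
    the claim.\<close>
  then have "(a \<times> b) \<times> (v \<times> (a \<times> b)) = 0" by simp
  then show ?thesis
    unfolding Lagrange[of "a \<times> b" v] by (simp add: inner_commute)
qed

text \<open>Both \<open>z\<close> and \<open>n\<close> are multiples of \<open>a \<times> b\<close>,
  and \<open>z\<close> is orthogonal to the nonzero \<open>n\<close>. This lets vector identities be
  checked against the two tangent vectors and the normal.\<close>

lemma orthogonal_basis_imp_zero:
  fixes z a b n :: "real^3"
  assumes "a \<times> b \<noteq> 0" "n \<noteq> 0" "n \<bullet> a = 0" "n \<bullet> b = 0"
    and "z \<bullet> a = 0" "z \<bullet> b = 0" "z \<bullet> n = 0"
  shows "z = 0"
proof -
  let ?w = "a \<times> b"
  have n: "(?w \<bullet> ?w) *\<^sub>R n = (n \<bullet> ?w) *\<^sub>R ?w" and z: "(?w \<bullet> ?w) *\<^sub>R z = (z \<bullet> ?w) *\<^sub>R ?w"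
    using assms orthogonal_both_imp_scaleR_cross by blast+
  have "n \<bullet> ?w \<noteq> 0"
    using n assms(1,2) by auto
  moreover have "(n \<bullet> ?w) * (z \<bullet> ?w) = z \<bullet> ((n \<bullet> ?w) *\<^sub>R ?w)" by simp
  then have "(n \<bullet> ?w) * (z \<bullet> ?w) = 0"
    unfolding n[symmetric] using assms(7) by simp
  ultimately show ?thesis using z assms(1) by simp
qed

lemma cross_frechet_derivative_nonzero:
  fixes y :: "real^2 \<Rightarrow> real^3"
  assumes "y differentiable (at u)" "inj (frechet_derivative y (at u))"
  shows "partial 1 y u \<times> partial 2 y u \<noteq> 0"
proof
  let ?L = "frechet_derivative y (at u)"
  have lin: "linear ?L" using assms(1) by (rule linear_frechet_derivative)
  assume "partial 1 y u \<times> partial 2 y u = 0"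
  then consider "?L (axis 1 1) = ?L 0" | "?L (axis 2 1) = ?L 0"
    | c where "?L (axis 2 1) = ?L (c *\<^sub>R axis 1 1)"
    unfolding cross_eq_0 collinear_lemma partial_def
    using linear_0[OF lin] linear_cmul[OF lin] by metis
  then show False
  proof cases
    case 1
    then show ?thesis using injD[OF assms(2)] by (metis axis_eq_0_iff zero_neq_one)
  next
    case 2
    then show ?thesis using injD[OF assms(2)] by (metis axis_eq_0_iff zero_neq_one)
  next
    case (3 c)
    then have "axis 2 1 = c *\<^sub>R (axis 1 1 :: real^2)" using injD[OF assms(2)] by blast
    from arg_cong[OF this, of "\<lambda>v. v $ 2"] show ?thesis by (simp add: axis_def)
  qed
qed

lemma matrix_inv_mult:
  fixes A :: "real^'n^'n"
  assumes "det A \<noteq> 0"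
  shows "A ** matrix_inv A = mat 1" "matrix_inv A ** A = mat 1"
proof -
  have "\<exists>B. A ** B = mat 1 \<and> B ** A = mat 1"
    using assms by (simp add: invertible_det_nz[symmetric] invertible_def)
  then have "A ** matrix_inv A = mat 1 \<and> matrix_inv A ** A = mat 1"
    unfolding matrix_inv_def by (rule someI_ex)
  then show "A ** matrix_inv A = mat 1" "matrix_inv A ** A = mat 1" by auto
qed

section \<open>Local computations in one parametrization\<close>

lemma beltrami2_inner_normal:
  fixes y f :: "real^2 \<Rightarrow> real^3"
  assumes "\<And>k. partial k f u = partial k y u"
    and "\<And>k l. partial k (partial l f) u = partial k (partial l y) u"
    and "\<And>k. partial k y u \<bullet> \<nu> u = 0" and "det (second_form y \<nu> u) \<noteq> 0"
  shows "beltrami2 (second_form y \<nu>) f u \<bullet> \<nu> u = - 2"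
proof -
  let ?b = "second_form y \<nu> u"
  \<comment> \<open>The Christoffel terms are tangential and vanish against \<open>\<nu>\<close>. By
    the index convention of \<open>second_form\<close>, \<open>partial i (partial j y)\<close> gives
    the entry \<open>$ j $ i\<close>; in this order the double sum is the trace of
    \<open>matrix_inv ?b ** ?b\<close>, namely the dimension 2.\<close>
  have "cov_deriv2 (second_form y \<nu>) i j f u \<bullet> \<nu> u = ?b $ j $ i" for i j
    using assms(1-3) by (simp add: cov_deriv2_def inner_diff_left inner_sum_left second_form_def)
  then have "beltrami2 (second_form y \<nu>) f u \<bullet> \<nu> u = - (\<Sum>i\<in>UNIV. (matrix_inv ?b ** ?b) $ i $ i)"
    by (simp add: beltrami2_def inner_sum_left matrix_matrix_mult_def)
  then show ?thesis
    by (simp add: matrix_inv_mult[OF assms(4)] mat_def)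
qed

lemma partial_cross:
  fixes f g :: "real^2 \<Rightarrow> real^3"
  assumes "f differentiable (at u)" "g differentiable (at u)"
  shows "(\<lambda>v. f v \<times> g v) differentiable (at u)"
    "partial i (\<lambda>v. f v \<times> g v) u = f u \<times> partial i g u + partial i f u \<times> g u"
proof -
  have "bounded_bilinear (\<times>)"
    using bilinear_cross bilinear_conv_bounded_bilinear by blast
  from bounded_bilinear.FDERIV[OF this has_derivative_partial has_derivative_partial, OF assms]
  have D: "((\<lambda>v. f v \<times> g v) has_derivative
     (\<lambda>h. f u \<times> frechet_derivative g (at u) h + frechet_derivative f (at u) h \<times> g u)) (at u)" .
  then show "(\<lambda>v. f v \<times> g v) differentiable (at u)"
    by (rule differentiableI)
  show "partial i (\<lambda>v. f v \<times> g v) u = f u \<times> partial i g u + partial i f u \<times> g u"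
    using partial_eqI[OF D] by (simp add: partial_def)
qed

lemma constant_support_imp_normal:
  fixes y \<nu> :: "real^2 \<Rightarrow> real^3"
  assumes "open U" "C_on 3 U y" "u \<in> U"
    and cr: "\<And>v. v \<in> U \<Longrightarrow> partial 1 y v \<times> partial 2 y v \<noteq> 0"
    and nu: "\<And>v. v \<in> U \<Longrightarrow> norm (\<nu> v) = 1" "\<And>v k. v \<in> U \<Longrightarrow> partial k y v \<bullet> \<nu> v = 0"
    and det: "det (second_form y \<nu> u) \<noteq> 0"
    and h: "\<And>v. v \<in> U \<Longrightarrow> (y v - c) \<bullet> \<nu> v = h" "h \<noteq> 0"
  shows "y u - c = h *\<^sub>R \<nu> u"
proof -
  \<comment> \<open>\<open>\<nu>\<close> is not known to be differentiable, but the cross product \<open>w = \<plusminus>\<bar>w\<bar>\<nu>\<close> is; squaring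
    \<open>\<langle>y - c, w\<rangle> = \<plusminus>h\<bar>w\<bar>\<close> removes the sign.\<close>
  define w where "w = (\<lambda>v. partial 1 y v \<times> partial 2 y v)"
  define p where "p = (\<lambda>v. y v - c)"
  have D: "w differentiable (at v)" "p differentiable (at v)" "partial k y differentiable (at v)"
    "partial k p v = partial k y v" if "v \<in> U" for v k
    using C_on_3D[OF assms(2) that] partial_diff_const
    by (auto simp: w_def p_def intro!: partial_cross)
  have wpar: "(w v \<bullet> w v) *\<^sub>R \<nu> v = (\<nu> v \<bullet> w v) *\<^sub>R w v" if "v \<in> U" for v
    unfolding w_def using nu(2)[OF that]
    by (intro orthogonal_both_imp_scaleR_cross) (simp_all add: inner_commute)
  have nn: "\<nu> v \<bullet> \<nu> v = 1" if "v \<in> U" for v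
    using nu(1)[OF that] by (simp add: norm_eq_1)
  have w0: "w v \<bullet> w v \<noteq> 0" if "v \<in> U" for v
    using cr[OF that] by (simp add: w_def)
  have sq: "(\<nu> v \<bullet> w v)^2 = w v \<bullet> w v" if "v \<in> U" for v
    using arg_cong[OF wpar[OF that], of "\<lambda>z. \<nu> v \<bullet> z"] nn[OF that]
    by (simp add: power2_eq_square)
  have wn: "w v = (\<nu> v \<bullet> w v) *\<^sub>R \<nu> v" if "v \<in> U" for v
  proof -
    have "(\<nu> v \<bullet> w v) *\<^sub>R w v = (\<nu> v \<bullet> w v) *\<^sub>R (\<nu> v \<bullet> w v) *\<^sub>R \<nu> v"
      using wpar[OF that] sq[OF that] by (simp add: power2_eq_square)
    moreover have "\<nu> v \<bullet> w v \<noteq> 0" using sq[OF that] w0[OF that] by auto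
    ultimately show ?thesis by (rule scaleR_left_imp_eq[rotated])
  qed
  \<comment> \<open>This is plus or minus the norm of \<open>w u\<close>. It is fixed at the point
    \<open>u\<close> only, since the sign of \<open>\<nu> v \<bullet> w v\<close> might vary with
    \<open>v\<close>.\<close>
  define \<sigma> where "\<sigma> = \<nu> u \<bullet> w u"
  have \<sigma>: "\<sigma> \<noteq> 0" "w u = \<sigma> *\<^sub>R \<nu> u"
    using sq[OF assms(3)] w0[OF assms(3)] wn[OF assms(3)] unfolding \<sigma>_def by auto
  have eq: "(p v \<bullet> w v) * (p v \<bullet> w v) = h^2 * (w v \<bullet> w v)" if "v \<in> U" for v
  proof -
    have "p v \<bullet> w v = (\<nu> v \<bullet> w v) * h"
      by (subst wn[OF that]) (simp add: p_def h(1)[OF that])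
    then show ?thesis using sq[OF that] by (simp add: power2_eq_square algebra_simps)
  qed
  have pw: "p u \<bullet> w u = \<sigma> * h"
    using \<sigma>(2) h(1)[OF assms(3)] by (simp add: p_def)
  have pdw: "(p u - h *\<^sub>R \<nu> u) \<bullet> partial k w u = 0" for k
  proof -
    \<comment> \<open>The other product-rule term, \<open>partial k p u \<bullet> w u\<close>,
      vanishes: \<open>p\<close> has the tangent derivatives of \<open>y\<close>, and
      \<open>w u\<close> is normal.\<close>
    have 1: "partial k (\<lambda>v. p v \<bullet> w v) u = p u \<bullet> partial k w u"
      using partial_inner[OF D(2,1)[OF assms(3)], of k] D(4)[OF assms(3)] \<sigma>(2) nu(2)[OF assms(3)] by simp
    have "(\<lambda>v. p v \<bullet> w v) differentiable (at u)"
      using D(1,2)[OF assms(3)] by simp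
    from partial_inner[OF this this, of k]
    have "partial k (\<lambda>v. (p v \<bullet> w v) * (p v \<bullet> w v)) u = 2 * (\<sigma> * h) * (p u \<bullet> partial k w u)"
      by (simp add: 1 pw inner_real_def)
    moreover have "(\<lambda>v. w v \<bullet> w v) differentiable (at u)"
      using D(1)[OF assms(3)] by simp
    from partial_inner[OF _ this, of "\<lambda>_. h^2" k]
    have "partial k (\<lambda>v. h^2 * (w v \<bullet> w v)) u = h^2 * (2 * (w u \<bullet> partial k w u))"
      using partial_inner[OF D(1,1)[OF assms(3)], of k]
        partial_eqI[OF has_derivative_const[of "h^2"], of k u]
      by (simp add: inner_real_def inner_commute)
    moreover have "partial k (\<lambda>v. (p v \<bullet> w v) * (p v \<bullet> w v)) u = partial k (\<lambda>v. h^2 * (w v \<bullet> w v)) u"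
      using eq by (intro partial_cong[OF assms(1,3)])
    ultimately have "\<sigma> * h * (p u \<bullet> partial k w u) = h^2 * \<sigma> * (\<nu> u \<bullet> partial k w u)"
      using \<sigma>(2) by auto
    then have "p u \<bullet> partial k w u = h * (\<nu> u \<bullet> partial k w u)"
      using \<sigma>(1) h(2) by (simp add: power2_eq_square)
    then show ?thesis by (simp add: inner_diff_left)
  qed
  \<comment> \<open>Weingarten's equation for the unnormalized normal \<open>w\<close>, from
    differentiating the orthogonality of \<open>partial l y\<close> and \<open>w\<close>.\<close>
  have ydw: "partial l y u \<bullet> partial k w u = - (\<sigma> * second_form y \<nu> u $ l $ k)" for k l
  proof -
    have "partial k (\<lambda>v. partial l y v \<bullet> w v) u = partial k (\<lambda>v. 0) u"
    proof (rule partial_cong[OF assms(1,3)])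
      fix v assume v: "v \<in> U"
      show "partial l y v \<bullet> w v = 0" by (subst wn[OF v]) (simp add: nu(2)[OF v])
    qed
    also have "\<dots> = 0" by (rule partial_eqI[OF has_derivative_const])
    finally show ?thesis
      using partial_inner[OF D(3,1)[OF assms(3)], of k l] \<sigma>(2)
      by (simp add: second_form_def)
  qed
  \<comment> \<open>The tangential part of the position vector relative to \<open>c\<close>; it has
    to vanish. By \<open>pdw\<close> it is orthogonal to both derivatives of
    \<open>w\<close>.\<close>
  define z where "z = p u - h *\<^sub>R \<nu> u"
  have "z \<bullet> \<nu> u = 0"
    using h(1)[OF assms(3)] nn[OF assms(3)] by (simp add: z_def p_def inner_diff_left)
  then have zw: "z \<bullet> w u = 0" using \<sigma>(2) by simp
  define a b where "a = partial 1 y u" and "b = partial 2 y u"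
  have wab: "w u = a \<times> b" by (simp add: w_def a_def b_def)
  \<comment> \<open>Expanding this double cross product by Lagrange's identity yields the
    coordinates of \<open>z\<close> in the basis \<open>a\<close>, \<open>b\<close>, up to the
    factor \<open>w u \<bullet> w u\<close>, without inverting the first fundamental form.\<close>
  have "(w u \<bullet> w u) *\<^sub>R z = w u \<times> (z \<times> w u)"
    using zw by (simp add: Lagrange inner_commute)
  also have "\<dots> = (z \<bullet> b) *\<^sub>R (w u \<times> a) - (z \<bullet> a) *\<^sub>R (w u \<times> b)"
    unfolding wab Lagrange[of z] by (simp add: Cross3.right_diff_distrib cross_mult_right)
  also have "w u \<times> a = (a \<bullet> a) *\<^sub>R b - (a \<bullet> b) *\<^sub>R a"
    unfolding wab by (subst cross_skew) (simp add: Lagrange)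
  also have "w u \<times> b = (a \<bullet> b) *\<^sub>R b - (b \<bullet> b) *\<^sub>R a"
    unfolding wab by (subst cross_skew) (simp add: Lagrange inner_commute)
  finally have "(w u \<bullet> w u) *\<^sub>R z = ((z \<bullet> a) * (b \<bullet> b) - (z \<bullet> b) * (a \<bullet> b)) *\<^sub>R a
      + ((z \<bullet> b) * (a \<bullet> a) - (z \<bullet> a) * (a \<bullet> b)) *\<^sub>R b"
    by (simp add: algebra_simps)
  then obtain \<alpha> \<beta> where z: "(w u \<bullet> w u) *\<^sub>R z = \<alpha> *\<^sub>R a + \<beta> *\<^sub>R b"
    by blast
  define S where "S = second_form y \<nu> u"
  have "0 = ((w u \<bullet> w u) *\<^sub>R z) \<bullet> partial k w u" for k
    using pdw[of k] by (simp add: z_def)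
  also have "\<dots> k = - \<sigma> * (\<alpha> * S $ 1 $ k + \<beta> * S $ 2 $ k)" for k
    unfolding z a_def b_def by (simp add: inner_add_left ydw S_def algebra_simps)
  finally have "\<alpha> * S $ 1 $ k + \<beta> * S $ 2 $ k = 0" for k
    using \<sigma>(1) by simp
  \<comment> \<open>The row vector with entries \<open>\<alpha>\<close>, \<open>\<beta>\<close> is
    annihilated by \<open>S\<close>; eliminating either unknown leaves the other times
    \<open>det S\<close>, as in Cramer's rule.\<close>
  from this[of 1] this[of 2]
  have "\<alpha> * det S = 0" "\<beta> * det S = 0"
    unfolding det_2 by algebra+
  then have "\<alpha> = 0" "\<beta> = 0" using det by (simp_all add: S_def)
  then have "z = 0" using z w0[OF assms(3)] by simp
  then show ?thesis by (simp add: z_def p_def)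
qed

lemma beltrami2_sphere:
  fixes y \<nu> :: "real^2 \<Rightarrow> real^3"
  assumes "open U" "C_on 3 U y" "u \<in> U"
    and cr: "partial 1 y u \<times> partial 2 y u \<noteq> 0"
    and nu: "\<And>v. v \<in> U \<Longrightarrow> norm (\<nu> v) = 1" "\<And>v k. v \<in> U \<Longrightarrow> partial k y v \<bullet> \<nu> v = 0"
    and det: "det (second_form y \<nu> u) \<noteq> 0"
    and a: "\<And>v. v \<in> U \<Longrightarrow> y v - c = a *\<^sub>R \<nu> v" "a \<noteq> 0"
  shows "beltrami2 (second_form y \<nu>) (\<lambda>v. y v - c) u = - 2 *\<^sub>R \<nu> u"
proof -
  let ?b = "second_form y \<nu>"
  define f where "f = (\<lambda>v. y v - c)"
  have D: "y differentiable (at v)" "partial k y differentiable (at v)"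
     "partial k (partial l y) differentiable (at v)" "partial k f v = partial k y v"
     if "v \<in> U" for v k l
    using C_on_3D[OF assms(2) that] partial_diff_const by (auto simp: f_def)
  have D2: "partial k (partial l f) u = partial k (partial l y) u" for k l
    using D(4) by (intro partial_cong[OF assms(1,3)])
  have comm: "partial k (partial l y) v = partial l (partial k y) v" if "v \<in> U" for k l v
    using partial_commute[OF assms(1) C_on_3_imp_2[OF assms(2)] that] .
  \<comment> \<open>Differentiating the orthogonality of \<open>partial j y\<close> and
    \<open>f = a *\<^sub>R \<nu>\<close> shows that II is \<open>- 1 / a\<close> times I. It is
    proved on all of \<open>U\<close>, so that it can be differentiated in turn at
    \<open>u\<close>.\<close>
  have b: "?b v $ j $ l = (- 1 / a) * (partial j y v \<bullet> partial l y v)" if "v \<in> U" for v j l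
  proof -
    have "partial l (\<lambda>v. partial j y v \<bullet> f v) v = partial l (\<lambda>v. 0) v"
      using a(1) nu(2) by (intro partial_cong[OF assms(1) that]) (simp add: f_def)
    also have "\<dots> = 0" by (rule partial_eqI[OF has_derivative_const])
    finally have "partial j y v \<bullet> partial l y v + partial l (partial j y) v \<bullet> f v = 0"
      using partial_inner[OF D(2)[OF that, of j], of f l] D(1,4)[OF that] by (simp add: f_def)
    then show ?thesis
      using a(1)[OF that] a(2) by (simp add: f_def second_form_def field_simps)
  qed
  have db: "partial i (\<lambda>v. ?b v $ j $ l) u =
      (- 1 / a) * (partial j y u \<bullet> partial i (partial l y) u + partial i (partial j y) u \<bullet> partial l y u)"
    for i j l
  proof -
    have "partial i (\<lambda>v. ?b v $ j $ l) u = partial i (\<lambda>v. ((- 1 / a) *\<^sub>R partial j y v) \<bullet> partial l y v) u"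
      by (rule partial_cong[OF assms(1,3)]) (simp add: b)
    also have "\<dots> = (- 1 / a) *\<^sub>R partial j y u \<bullet> partial i (partial l y) u +
        partial i (\<lambda>v. (- 1 / a) *\<^sub>R partial j y v) u \<bullet> partial l y u"
      by (intro partial_inner D(2)[OF assms(3)] differentiable_scaleR differentiable_const)
    also have "partial i (\<lambda>v. (- 1 / a) *\<^sub>R partial j y v) u = (- 1 / a) *\<^sub>R partial i (partial j y) u"
      unfolding partial_def[of i "partial j y"]
      by (rule partial_eqI) (intro has_derivative_scaleR_right has_derivative_partial D(2)[OF assms(3)])
    finally show ?thesis by (simp add: algebra_simps)
  qed
  \<comment> \<open>Tangential part of Gauss' formula, paired with \<open>partial m y\<close>: the
    Christoffel symbols of II act as those of I.\<close>
  have chr: "(\<Sum>k\<in>UNIV. christoffel ?b k i j u * (partial k y u \<bullet> partial m y u))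
      = partial i (partial j y) u \<bullet> partial m y u" for i j m
  proof -
    define E where "E = (\<lambda>l. partial i (\<lambda>v. ?b v $ j $ l) u + partial j (\<lambda>v. ?b v $ i $ l) u
         - partial l (\<lambda>v. ?b v $ i $ j) u)"
    have christoffel_eq: "christoffel ?b k i j u = (\<Sum>l\<in>UNIV. matrix_inv (?b u) $ k $ l * E l) / 2" for k
      by (simp only: christoffel_def E_def)
    \<comment> \<open>Of the six terms, symmetry of second derivatives cancels four in pairs and
      merges the other two, whence the factor 2.\<close>
    have E: "E l = (- 2 / a) * (partial i (partial j y) u \<bullet> partial l y u)" for l
      unfolding E_def db
      using comm[OF assms(3), of j i] comm[OF assms(3), of l i] comm[OF assms(3), of l j]
      by (simp add: algebra_simps inner_commute)
    \<comment> \<open>Trading I for \<open>- a\<close> times II brings the second form next to its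
      own inverse, so the sum over \<open>k\<close> collapses.\<close>
    have "(\<Sum>k\<in>UNIV. christoffel ?b k i j u * (partial k y u \<bullet> partial m y u))
       = (- a) * (\<Sum>k\<in>UNIV. christoffel ?b k i j u * ?b u $ m $ k)"
      using a(2) by (simp add: b[OF assms(3)] sum_distrib_left inner_commute)
    also have "(\<Sum>k\<in>UNIV. christoffel ?b k i j u * ?b u $ m $ k)
       = (\<Sum>l\<in>UNIV. (?b u ** matrix_inv (?b u)) $ m $ l * E l) / 2"
      unfolding christoffel_eq by (simp add: matrix_matrix_mult_def sum_2 field_simps)
    also have "\<dots> = E m / 2"
      by (simp add: matrix_inv_mult[OF det] mat_def if_distrib[of "\<lambda>x. x * _"] cong: if_cong)
    finally show ?thesis using a(2) by (simp add: E)
  qed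
  \<comment> \<open>The defect in the claimed identity; it is tested against both tangent vectors
    (by \<open>chr\<close>) and the normal (where -2 and 2 cancel).\<close>
  define z where "z = beltrami2 ?b f u + 2 *\<^sub>R \<nu> u"
  have "z \<bullet> partial m y u = 0" for m
    using nu(2)[OF assms(3), of m] chr[of _ _ m] D(4)[OF assms(3)] D2
    by (simp add: z_def beltrami2_def cov_deriv2_def inner_add_left inner_sum_left inner_diff_left
      inner_commute[of "\<nu> u"])
  moreover have "z \<bullet> \<nu> u = 0"
    using beltrami2_inner_normal[OF _ _ nu(2)[OF assms(3)] det, of f] D(4)[OF assms(3)] D2
      nu(1)[OF assms(3)]
    by (simp add: z_def inner_add_left norm_eq_1)
  moreover have "\<nu> u \<noteq> 0" using nu(1)[OF assms(3)] by auto
  ultimately have "z = 0"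
    using orthogonal_basis_imp_zero[OF cr] nu(2)[OF assms(3)] by (simp add: inner_commute)
  then show ?thesis by (simp add: z_def f_def eq_neg_iff_add_eq_0)
qed

section \<open>From local parametrizations to the surface\<close>

lemma local_paramD:
  assumes "local_param M x U \<phi>"
  shows "open U" "C_on 3 U (x \<circ> \<phi>)" "\<phi> ` U \<subseteq> topspace M"
    "u \<in> U \<Longrightarrow> partial 1 (x \<circ> \<phi>) u \<times> partial 2 (x \<circ> \<phi>) u \<noteq> 0"
proof -
  show "open U" "C_on 3 U (x \<circ> \<phi>)" "\<phi> ` U \<subseteq> topspace M"
    using assms openin_subset unfolding local_param_def by blast+
  then show "partial 1 (x \<circ> \<phi>) u \<times> partial 2 (x \<circ> \<phi>) u \<noteq> 0" if "u \<in> U"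
    using assms that C_on_3D(1) unfolding local_param_def
    by (intro cross_frechet_derivative_nonzero) blast+
qed

text \<open>Smoothness is given only in parameters. It yields continuity on \<open>M\<close> because
  parametrizations are open maps onto open patches, so preimages of open sets are neighbourhoods of
  their points. The connectedness argument for the sphere relies on this.\<close>

lemma continuous_map_position:
  assumes "surface M x"
  shows "continuous_map M euclidean x"
  unfolding continuous_map_def
proof (intro conjI allI impI)
  fix V :: "(real^3) set" assume "openin euclidean V"
  then have V: "open V" by simp
  show "openin M {p \<in> topspace M. x p \<in> V}"
  proof (subst openin_subopen, intro ballI)
    fix p assume p: "p \<in> {p \<in> topspace M. x p \<in> V}"
    then obtain U \<phi> where L: "local_param M x U \<phi>" and "p \<in> \<phi> ` U"
      using assms unfolding surface_def by blast
    have "continuous_on U (x \<circ> \<phi>)"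
      using C_on_3D(1)[OF local_paramD(2)[OF L]]
      by (intro continuous_at_imp_continuous_on ballI differentiable_imp_continuous_within)
    then have "open (U \<inter> (x \<circ> \<phi>) -` V)"
      using V local_paramD(1)[OF L] by (metis continuous_on_open_vimage Int_commute)
    then have "openin (top_of_set U) (U \<inter> (x \<circ> \<phi>) -` V)"
      by (auto simp: openin_open)
    moreover have "open_map (top_of_set U) (subtopology M (\<phi> ` U)) \<phi>"
      using L unfolding local_param_def embedding_map_def
      by (auto intro: homeomorphic_imp_open_map)
    ultimately have "openin (subtopology M (\<phi> ` U)) (\<phi> ` (U \<inter> (x \<circ> \<phi>) -` V))"
      unfolding open_map_def by blast
    then have "openin M (\<phi> ` (U \<inter> (x \<circ> \<phi>) -` V))"
      using L openin_trans_full unfolding local_param_def by blast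
    moreover have "\<phi> ` (U \<inter> (x \<circ> \<phi>) -` V) \<subseteq> {p \<in> topspace M. x p \<in> V}"
      using local_paramD(3)[OF L] by auto
    ultimately show "\<exists>T. openin M T \<and> p \<in> T \<and> T \<subseteq> {p \<in> topspace M. x p \<in> V}"
      using p \<open>p \<in> \<phi> ` U\<close> by (intro exI[of _ "\<phi> ` (U \<inter> (x \<circ> \<phi>) -` V)"]) auto
  qed
qed auto

lemma gauss_mapD:
  assumes "gauss_map M x n" "local_param M x U \<phi>" "u \<in> U"
  shows "norm ((n \<circ> \<phi>) u) = 1" "partial k (x \<circ> \<phi>) u \<bullet> (n \<circ> \<phi>) u = 0"
  using assms local_paramD(3)[OF assms(2)] unfolding gauss_map_def by auto

text \<open>A zero numerator would make the curvature zero. The nonzero determinant makes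
  \<open>matrix_inv\<close> of the second form a genuine inverse.\<close>

lemma elliptic_surfaceD:
  assumes "elliptic_surface M x n" "local_param M x U \<phi>" "u \<in> U"
  shows "det (second_form (x \<circ> \<phi>) (n \<circ> \<phi>) u) \<noteq> 0"
  using assms unfolding elliptic_surface_def gauss_curvature_def by force

text \<open>Differentiating the constant squared distance to \<open>c\<close> shows that
  \<open>x - c\<close> is normal, hence \<open>s\<close> times \<open>n\<close> with
  \<open>s\<close> equal to \<open>r\<close> or \<open>- r\<close>. Being continuous with at most
  two values on a connected space, \<open>s\<close> is constant: the normal cannot switch between
  inner and outer.\<close>

lemma sphere_position_eq_normal:
  assumes "surface M x" "connected_space M" "gauss_map M x n"
    and "r > 0" and S: "x ` topspace M \<subseteq> sphere c r"
  obtains a where "a \<noteq> 0" "\<And>p. p \<in> topspace M \<Longrightarrow> x p - c = a *\<^sub>R n p"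
proof -
  define s where "s = (\<lambda>p. (x p - c) \<bullet> n p)"
  have par: "x p - c = s p *\<^sub>R n p \<and> s p \<in> {r, - r}" if p: "p \<in> topspace M" for p
  proof -
    obtain U \<phi> u where L: "local_param M x U \<phi>" and u: "u \<in> U" "p = \<phi> u"
      using assms(1) p unfolding surface_def by blast
    define y where "y = x \<circ> \<phi>"
    define z where "z = (x p - c) - s p *\<^sub>R n p"
    note nu = gauss_mapD[OF assms(3) L u(1)]
    have nn: "n p \<bullet> n p = 1" using nu(1) u by (simp add: norm_eq_1)
    have rr: "(y v - c) \<bullet> (y v - c) = r^2" if "v \<in> U" for v
    proof -
      have "dist c (y v) = r"
        using subsetD[OF S, of "y v"] local_paramD(3)[OF L] that by (auto simp: y_def)
      then show ?thesis
        by (simp add: dist_norm norm_minus_commute power2_norm_eq_inner[symmetric])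
    qed
    have dy: "y differentiable (at u)"
      using C_on_3D(1)[OF local_paramD(2)[OF L] u(1)] by (simp add: y_def)
    have "(y u - c) \<bullet> partial k y u = 0" for k
    proof -
      have "partial k (\<lambda>v. (y v - c) \<bullet> (y v - c)) u = partial k (\<lambda>v. r^2) u"
        using rr by (intro partial_cong[OF local_paramD(1)[OF L] u(1)])
      also have "\<dots> = 0" by (rule partial_eqI[OF has_derivative_const])
      finally show ?thesis
        using partial_inner[of "\<lambda>v. y v - c" u "\<lambda>v. y v - c" k] dy partial_diff_const[OF dy, of k c]
        by (simp add: inner_commute)
    qed
    then have "z \<bullet> partial k y u = 0" for k
      using nu(2)[of k] u by (simp add: z_def y_def inner_diff_left inner_diff_right inner_commute)
    moreover have "z \<bullet> n p = 0"
      using nn by (simp add: z_def s_def inner_diff_left)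
    moreover have "n p \<bullet> partial k y u = 0" for k
      using nu(2)[of k] u by (simp add: y_def inner_commute)
    moreover have "n p \<noteq> 0" using nn by auto
    ultimately have "z = 0"
      using orthogonal_basis_imp_zero[OF local_paramD(4)[OF L u(1), folded y_def]] by blast
    then have xp: "x p - c = s p *\<^sub>R n p" by (simp add: z_def)
    then have "(s p)^2 = r^2"
      using rr[OF u(1)] u(2) nn by (simp add: y_def power2_eq_square)
    then show ?thesis using xp by (simp add: power2_eq_iff)
  qed
  have "continuous_map M euclidean s"
  proof -
    have "continuous_map M euclidean (\<lambda>p. (x p, n p))"
      using continuous_map_paired[of M euclidean euclidean x n]
        continuous_map_position[OF assms(1)] assms(3)
      by (simp add: gauss_map_def)
    moreover have "continuous_map euclidean euclidean (\<lambda>(q, m). (q - c) \<bullet> m)"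
      by (simp add: case_prod_unfold continuous_intros)
    ultimately have "continuous_map M euclidean ((\<lambda>(q, m). (q - c) \<bullet> m) \<circ> (\<lambda>p. (x p, n p)))"
      by (rule continuous_map_compose)
    then show ?thesis by (simp add: s_def o_def)
  qed
  then have "connectedin euclidean (s ` topspace M)"
    using assms(2) connectedin_continuous_map_image connectedin_topspace by blast
  then have conn: "connected (s ` topspace M)" by simp
  obtain p0 where p0: "p0 \<in> topspace M" using assms(1) unfolding surface_def by blast
  have "finite (s ` topspace M)"
    by (rule finite_subset[of _ "{r, - r}"]) (use par in auto)
  then obtain a where "s ` topspace M = {a}"
    using connected_finite_iff_sing[OF conn] p0 by auto
  then have sa: "s p = a" if "p \<in> topspace M" for p using that by auto
  moreover have "a \<noteq> 0" using par[OF p0] sa[OF p0] assms(4) by auto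
  ultimately show thesis using par that by metis
qed

section \<open>The two implications and their combination\<close>

lemma II_type_1_imp_part_of_sphere:
  assumes "surface M x" "gauss_map M x n" "elliptic_surface M x n" "II_type 1 M x n"
  shows "part_of_sphere M x"
proof -
  obtain c X \<mu> where X: "\<And>p. p \<in> topspace M \<Longrightarrow> x p = c + X p" and E: "II_eigenfunction M x n X \<mu>"
    using assms(4) unfolding II_type_def by auto
  \<comment> \<open>The eigenvalue equation paired with the normal: its left side is -2 by
    \<open>beltrami2_inner_normal\<close>, since \<open>X\<close> and \<open>x\<close> differ by a
    constant.\<close>
  have support: "\<mu> * ((x p - c) \<bullet> n p) = - 2" if p: "p \<in> topspace M" for p
  proof -
    obtain U \<phi> u where L: "local_param M x U \<phi>" and u: "u \<in> U" "p = \<phi> u"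
      using assms(1) p unfolding surface_def by blast
    note U = local_paramD[OF L]
    have "partial k (X \<circ> \<phi>) v = partial k (x \<circ> \<phi>) v" if "v \<in> U" for k v
    proof -
      have "partial k (X \<circ> \<phi>) v = partial k (\<lambda>v. (x \<circ> \<phi>) v - c) v"
        using U(3) X by (intro partial_cong[OF U(1) that]) auto
      then show ?thesis using partial_diff_const[OF C_on_3D(1)[OF U(2) that]] by metis
    qed
    moreover from this have "partial k (partial l (X \<circ> \<phi>)) u = partial k (partial l (x \<circ> \<phi>)) u" for k l
      by (intro partial_cong[OF U(1) u(1)])
    ultimately have "beltrami2 (second_form (x \<circ> \<phi>) (n \<circ> \<phi>)) (X \<circ> \<phi>) u \<bullet> (n \<circ> \<phi>) u = - 2"
      using u gauss_mapD(2)[OF assms(2) L u(1)] elliptic_surfaceD[OF assms(3) L u(1)]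
      by (intro beltrami2_inner_normal) auto
    then show ?thesis
      using E L u X[OF p] unfolding II_eigenfunction_def by auto
  qed
  \<comment> \<open>Otherwise \<open>support\<close> at any point of the nonempty surface would read
    0 = -2.\<close>
  have mu: "\<mu> \<noteq> 0"
    using support assms(1) unfolding surface_def by fastforce
  \<comment> \<open>The constant support value solved from \<open>support\<close>. Its sign depends
    on the orientation of \<open>n\<close>, so the radius is \<open>\<bar>h\<bar>\<close>.\<close>
  define h where "h = - 2 / \<mu>"
  have h: "h \<noteq> 0" using mu by (simp add: h_def)
  have "dist c (x p) = \<bar>h\<bar>" if p: "p \<in> topspace M" for p
  proof -
    obtain U \<phi> u where L: "local_param M x U \<phi>" and u: "u \<in> U" "p = \<phi> u"
      using assms(1) p unfolding surface_def by blast
    note U = local_paramD[OF L]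
    have hv: "((x \<circ> \<phi>) v - c) \<bullet> (n \<circ> \<phi>) v = h" if "v \<in> U" for v
      using support[of "\<phi> v"] U(3) that mu by (auto simp: h_def field_simps)
    have "(x \<circ> \<phi>) u - c = h *\<^sub>R (n \<circ> \<phi>) u"
      by (rule constant_support_imp_normal[OF U(1,2) u(1) U(4) gauss_mapD[OF assms(2) L]
            elliptic_surfaceD[OF assms(3) L u(1)] hv h])
    then have "norm (x p - c) = \<bar>h\<bar>"
      using gauss_mapD(1)[OF assms(2) L u(1)] u(2) by simp
    then show ?thesis by (simp add: dist_norm norm_minus_commute)
  qed
  then show ?thesis
    unfolding part_of_sphere_def using h by (intro exI[of _ c] exI[of _ "\<bar>h\<bar>"]) auto
qed

text \<open>A constant position vector would have zero partial derivatives, contradicting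
  immersivity. The shift by \<open>c\<close> matches the eigenvector used for the sphere.\<close>

lemma position_not_constant:
  assumes "surface M x"
  shows "\<not> (\<lambda>p. x p - c) constant_on topspace M"
proof
  assume "(\<lambda>p. x p - c) constant_on topspace M"
  then obtain d where d: "\<And>p. p \<in> topspace M \<Longrightarrow> x p = d"
    unfolding constant_on_def by (metis diff_add_cancel)
  obtain U \<phi> u where L: "local_param M x U \<phi>" and u: "u \<in> U"
    using assms unfolding surface_def by blast
  note U = local_paramD[OF L]
  have "partial 1 (x \<circ> \<phi>) u = partial 1 (\<lambda>_. d) u"
    using U(3) d by (intro partial_cong[OF U(1) u]) auto
  also have "\<dots> = 0" by (rule partial_eqI[OF has_derivative_const])
  finally show False using U(4)[OF u] by simp
qed

lemma part_of_sphere_imp_II_type_1: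
  assumes "surface M x" "connected_space M" "gauss_map M x n" "elliptic_surface M x n"
    and "part_of_sphere M x"
  shows "II_type 1 M x n"
proof -
  obtain c r where "r > 0" "x ` topspace M \<subseteq> sphere c r"
    using assms(5) unfolding part_of_sphere_def by blast
  then obtain a where a: "a \<noteq> 0" "\<And>p. p \<in> topspace M \<Longrightarrow> x p - c = a *\<^sub>R n p"
    using sphere_position_eq_normal[OF assms(1-3)] by metis
  \<comment> \<open>The eigenvalue comes from rewriting \<open>- 2 *\<^sub>R n\<close> by means of
    \<open>x - c = a *\<^sub>R n\<close>.\<close>
  have "II_eigenfunction M x n (\<lambda>p. x p - c) (- 2 / a)"
    unfolding II_eigenfunction_def
  proof (intro allI impI conjI ballI)
    fix U \<phi> assume L: "local_param M x U \<phi>"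
    note U = local_paramD[OF L]
    have comp: "(\<lambda>p. x p - c) \<circ> \<phi> = (\<lambda>v. (x \<circ> \<phi>) v - c)" by auto
    show "C_on 2 U ((\<lambda>p. x p - c) \<circ> \<phi>)"
      unfolding comp by (intro C_on_diff_const U(1) C_on_3_imp_2 U(2))
    fix u assume u: "u \<in> U"
    have av: "(x \<circ> \<phi>) v - c = a *\<^sub>R (n \<circ> \<phi>) v" if "v \<in> U" for v
      using a(2) U(3) that by auto
    have "beltrami2 (second_form (x \<circ> \<phi>) (n \<circ> \<phi>)) (\<lambda>v. (x \<circ> \<phi>) v - c) u = - 2 *\<^sub>R (n \<circ> \<phi>) u"
      by (rule beltrami2_sphere[OF U(1,2) u U(4)[OF u] gauss_mapD[OF assms(3) L]
            elliptic_surfaceD[OF assms(4) L u] av a(1)])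
    then show "beltrami2 (second_form (x \<circ> \<phi>) (n \<circ> \<phi>)) ((\<lambda>p. x p - c) \<circ> \<phi>) u
        = (- 2 / a) *\<^sub>R (x (\<phi> u) - c)"
      using av[OF u] a(1) by (simp add: comp)
  qed
  then show ?thesis
    unfolding II_type_def using position_not_constant[OF assms(1), of c]
    by (intro exI[of _ c] exI[of _ "\<lambda>_ p. x p - c"] exI[of _ "\<lambda>_. - 2 / a"])
      (auto simp: inj_on_def)
qed

theorem theorem2p1:
  fixes M :: "'a topology" and x n :: "'a \<Rightarrow> real^3"
  assumes "surface M x" and "connected_space M" and "gauss_map M x n"
    and "elliptic_surface M x n"
  shows "II_type 1 M x n \<longleftrightarrow> part_of_sphere M x"
  using assms II_type_1_imp_part_of_sphere part_of_sphere_imp_II_type_1 by blast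

end
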